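(* Let $n\ge1$, $\delta>0$, $\beta<n+4$, $s\in\mathbb{R}$ and $f\in H^s(T^n)$. Let $N\in\mathbb{N}\cup\{0\}$ and define, for $t\ge0$, $$U^{(N)}(t)=\sum_{k\in\mathbb{Z}^n}\hat f_k\,m(\nu_k)^{N}e^{m(\nu_k)t}e^{i\nu_k\cdot x},\qquad V^{(N)}(t)=\sum_{k\in\mathbb{Z}^n}\hat f_k\,m(\nu_k)^{N+1}e^{m(\nu_k)t}e^{i\nu_k\cdot x}.$$ Then $\frac{d}{dt}U^{(N)}(t)=V^{(N)}(t)$ for all $t\in(0,\infty)$, in the sense of Gateaux differentiation. Equivalently, with $U(t)=\sum_{k}\hat f_k e^{m(\nu_k)t}e^{i\nu_k\cdot x}$, $$\frac{d^N}{dt^N}U(t)=\sum_{k\in\mathbb{Z}^n}\hat f_k\,m(\nu_k)^{N}e^{m(\nu_k)t}e^{i\nu_k\cdot x}\qquad (t>0).$$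
   Context: Let $r_1,\dots,r_n>0$ and let $T^n=\prod_{i=1}^n[0,r_i]$ be the periodic torus (opposite faces identified). For $k\in\mathbb{Z}^n$ put $\nu_k=\left(\frac{2\pi k_1}{r_1},\dots,\frac{2\pi k_n}{r_n}\right)$. A periodic distribution $h$ on $T^n$ is written through its Fourier coefficients as $h=\sum_{k\in\mathbb{Z}^n}\hat h_k e^{i\nu_k\cdot x}$. For $s\in\mathbb{R}$, $H^s(T^n)$ is the space of periodic distributions with $\|h\|_{H^s(T^n)}^2:=\sum_{k\in\mathbb{Z}^n}(1+\|k\|^2)^s|\hat h_k|^2<\infty$. For $n\ge1$, $\delta>0$, $\beta<n+4$, the Fourier multiplier is $$m(\nu)=m^{\delta,\beta}(\nu)=-\|\nu\|^2\;{}_2F_3\!\left(1,\tfrac{n+2-\beta}{2};\,2,\tfrac{n+2}{2},\tfrac{n+4-\beta}{2};\,-\tfrac14\|\nu\|^2\delta^2\right),\quad \nu\in\mathbb{R}^n.$$ For $\beta<n+2$ it equals $c^{\delta,\beta}\int_{B_\delta(0)}\frac{\cos(\nu\cdot z)-1}{\|z\|^\beta}dz$ with $c^{\delta,\beta}=\frac{2(n+2-\beta)\Gamma(\frac n2+1)}{\pi^{n/2}\delta^{n+2-\beta}}$; for $\beta=n+2$ it equals $-\|\nu\|^2$. The convention $0^0=1$ is used. Gateaux differentiation: $\frac{d}{dt}W(t)=Z(t)$ means $\lim_{h\to0}\left\|\frac1h[W(t+h)-W(t)]-Z(t)\right\|_{H^q(T^n)}=0$, where $q=s$ when $\beta\le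 n$, and $q\in\mathbb{R}$ is arbitrary (every $q$) when $n<\beta<n+4$. *)

theory Defs
  imports "HOL-Analysis.Analysis"
begin

text \<open>
  The dimension \<open>n\<close> of the torus is \<open>CARD('n)\<close>, and \<open>r :: real ^ 'n\<close> is the vector of its side lengths.
  A periodic distribution \<open>h\<close> on the torus is represented by its family of Fourier coefficients
  \<open>k \<mapsto> h k\<close>, standing for the series of the terms \<open>h k * exp (i \<nu>\<^sub>k \<bullet> x)\<close>; the families that
  arise in this way are exactly those of at most polynomial growth.
\<close>

type_synonym 'n fourier_coeffs = "int ^ 'n \<Rightarrow> complex"

definition index_norm :: "int ^ 'n::finite \<Rightarrow> real" where
  "index_norm k = norm (\<chi> i. real_of_int (k $ i))"

definition periodic_distribution :: "('n::finite) fourier_coeffs \<Rightarrow> bool" where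
  "periodic_distribution h \<longleftrightarrow>
     (\<exists>C p. \<forall>k. cmod (h k) \<le> C * (1 + (index_norm k)\<^sup>2) powr p)"

definition frequency :: "real ^ 'n::finite \<Rightarrow> int ^ 'n \<Rightarrow> real ^ 'n" where
  "frequency r k = (\<chi> i. 2 * pi * real_of_int (k $ i) / r $ i)"

definition multiplier :: "real \<Rightarrow> real \<Rightarrow> real ^ 'n::finite \<Rightarrow> real" where
  "multiplier \<delta> \<beta> \<nu> =
     (let n = real CARD('n) in
      - (norm \<nu>)\<^sup>2 *
        eval_fps (fps_hypergeo [1, (n + 2 - \<beta>) / 2] [2, (n + 2) / 2, (n + 4 - \<beta>) / 2] 1)
          (- (1 / 4) * (norm \<nu>)\<^sup>2 * \<delta>\<^sup>2))"

definition sobolev_space :: "real \<Rightarrow> ('n::finite) fourier_coeffs set" where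
  "sobolev_space s =
     {h. periodic_distribution h \<and>
         (\<lambda>k. (1 + (index_norm k)\<^sup>2) powr s * (cmod (h k))\<^sup>2) summable_on UNIV}"

text \<open>The value of \<open>sobolev_norm s h\<close> is meaningful only for \<open>h \<in> sobolev_space s\<close>.\<close>

definition sobolev_norm :: "real \<Rightarrow> ('n::finite) fourier_coeffs \<Rightarrow> real" where
  "sobolev_norm s h = sqrt (\<Sum>\<^sub>\<infinity>k. (1 + (index_norm k)\<^sup>2) powr s * (cmod (h k))\<^sup>2)"

text \<open>
  The orders \<open>q\<close> of the Sobolev norms with respect to which difference quotients have to converge.
\<close>

definition gateaux_orders :: "'n::finite itself \<Rightarrow> real \<Rightarrow> real \<Rightarrow> real set" where
  "gateaux_orders _ \<beta> s = (if \<beta> \<le> real CARD('n) then {s} else UNIV)"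

text \<open>
  Membership in \<open>sobolev_space q\<close> is demanded explicitly because \<open>sobolev_norm\<close> is \<open>0\<close> on families
  for which the defining sum diverges.
\<close>

definition has_gateaux_derivative ::
  "real set \<Rightarrow> (real \<Rightarrow> ('n::finite) fourier_coeffs) \<Rightarrow> 'n fourier_coeffs \<Rightarrow> real \<Rightarrow> bool" where
  "has_gateaux_derivative Q W Z t \<longleftrightarrow>
     (\<forall>q\<in>Q.
        (\<forall>\<^sub>F h in at 0. (\<lambda>k. (W (t + h) k - W t k) / of_real h - Z k) \<in> sobolev_space q) \<and>
        ((\<lambda>h. sobolev_norm q (\<lambda>k. (W (t + h) k - W t k) / of_real h - Z k)) \<longlongrightarrow> 0) (at 0))"

text \<open>Iterated differentiation on the open half-line \<open>t > 0\<close>.\<close>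

primrec has_nth_gateaux_derivative ::
  "real set \<Rightarrow> nat \<Rightarrow> (real \<Rightarrow> ('n::finite) fourier_coeffs) \<Rightarrow> (real \<Rightarrow> 'n fourier_coeffs) \<Rightarrow> bool"
where
  "has_nth_gateaux_derivative Q 0 W Z \<longleftrightarrow> (\<forall>t>0. Z t = W t)"
| "has_nth_gateaux_derivative Q (Suc N) W Z \<longleftrightarrow>
     (\<exists>Y. has_nth_gateaux_derivative Q N W Y \<and> (\<forall>t>0. has_gateaux_derivative Q Y (Z t) t))"

end

theory Submission
  imports Defs
begin

text \<open>
  Put \<open>p = n / 2\<close>, \<open>a = (n + 2 - \<beta>) / 2 > -1\<close> and \<open>w = \<delta>\<^sup>2 \<parallel>\<nu>\<parallel>\<^sup>2 / 4\<close>. The multiplier is \<open>-(4 / \<delta>\<^sup>2) w G w\<close>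
  with \<open>G w = \<^sub>2F\<^sub>3(1, a; 2, p + 1, a + 1; -w)\<close>, and \<open>w G' = a (\<Phi> - G)\<close> for \<open>\<Phi> w = \<^sub>1F\<^sub>2(1; 2, p + 1; -w)\<close>,
  where \<open>w \<Phi> w = p (1 - \<^sub>0F\<^sub>1(; p; -w))\<close>. An energy argument for the Bessel type function \<open>\<^sub>0F\<^sub>1\<close> gives
  \<open>0 \<le> \<Phi> \<le> 1\<close>, so \<open>w powr a * (G - c)\<close> is monotone for suitable constants \<open>c\<close>. Without any asymptotic
  expansion this shows that the multiplier is nonpositive and of polynomial growth, and that it tends
  to \<open>-\<infinity>\<close> at least like a negative multiple of a power of \<open>\<parallel>\<nu>\<parallel>\<close> when \<open>\<beta> > n\<close>.

  By Taylor's formula for \<open>exp\<close>, the difference quotient minus the derivative has \<open>k\<close>-th coefficient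
  at most \<open>\<bar>h\<bar> \<bar>m\<bar>^(N + 2) exp (m t / 2) \<bar>f k\<bar>\<close>. One half of the exponential absorbs the powers of \<open>m\<close>
  and, when \<open>\<beta> > n\<close>, the other half absorbs the change of Sobolev order from \<open>s\<close> to \<open>q\<close>.
\<close>

section \<open>Hypergeometric series on the negative half-line\<close>

lemma fps_conv_radius_inftyI_fact:
  fixes F :: "real fps"
  assumes "\<And>j. \<bar>fps_nth F j\<bar> \<le> C / fact j"
  shows "fps_conv_radius F = \<infinity>"
  unfolding fps_conv_radius_def
proof (rule conv_radius_inftyI'')
  fix z :: real
  have "summable (\<lambda>j. C * (inverse (fact j) * \<bar>z\<bar> ^ j))"
    by (intro summable_mult summable_exp)
  then show "summable (\<lambda>j. fps_nth F j * z ^ j)"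
  proof (rule summable_comparison_test'[where N = 0])
    fix j
    have "norm (fps_nth F j * z ^ j) = \<bar>fps_nth F j\<bar> * \<bar>z\<bar> ^ j"
      by (simp add: abs_mult power_abs)
    also have "\<dots> \<le> C / fact j * \<bar>z\<bar> ^ j"
      by (intro mult_right_mono assms) auto
    finally show "norm (fps_nth F j * z ^ j) \<le> C * (inverse (fact j) * \<bar>z\<bar> ^ j)"
      by (simp add: field_simps)
  qed
qed

text \<open>Only the first factor \<open>p\<close> can lie below 1; every later factor is at least
  \<open>p + 1\<close>.\<close>

lemma pochhammer_ge_min:
  fixes p :: real
  assumes "0 < p"
  shows "min 1 p \<le> pochhammer p j"
proof (cases j)
  case (Suc i)
  have "1 \<le> pochhammer (p + 1) i"
  proof (induction i)
    case (Suc i)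
    have "1 * 1 \<le> pochhammer (p + 1) i * (p + 1 + real i)"
      using Suc assms by (intro mult_mono) auto
    then show ?case by (simp add: pochhammer_Suc)
  qed auto
  then have "p * 1 \<le> p * pochhammer (p + 1) i"
    using assms by (intro mult_left_mono) auto
  then show ?thesis by (simp add: Suc pochhammer_rec)
qed auto

lemma conv_radius_hypergeo_0F1:
  assumes "0 < (p :: real)"
  shows "fps_conv_radius (fps_hypergeo [] [p] 1) = \<infinity>"
proof (rule fps_conv_radius_inftyI_fact)
  fix j
  have "min 1 p \<le> pochhammer p j" by (rule pochhammer_ge_min[OF assms])
  with assms show "\<bar>fps_nth (fps_hypergeo [] [p] 1) j\<bar> \<le> (1 / min 1 p) / fact j"
    by (auto simp: abs_mult pochhammer_pos intro!: divide_left_mono mult_right_mono)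
qed

text \<open>The upper parameter 1 contributes \<open>fact j\<close>, which cancels the factorial
  built into the series; the lower parameter 2 contributes \<open>fact (Suc j)\<close>.\<close>

lemma fps_nth_hypergeo_1F2:
  fixes p :: real
  shows "fps_nth (fps_hypergeo [1] [2, p + 1] 1) j = 1 / (fact (Suc j) * pochhammer (p + 1) j)"
proof -
  have "pochhammer 2 j = (fact (Suc j) :: real)"
    using pochhammer_rec[of "1::real" j] by (simp add: pochhammer_fact)
  then show ?thesis
    by (simp add: pochhammer_fact[symmetric] del: fact_Suc)
qed

lemma abs_hypergeo_1F2_le:
  assumes "0 < (p :: real)"
  shows "\<bar>fps_nth (fps_hypergeo [1] [2, p + 1] 1) j\<bar> \<le> 1 / fact j"
proof -
  have "1 \<le> pochhammer (p + 1) j"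
    using pochhammer_ge_min[of "p + 1" j] assms by simp
  moreover have "fact j \<le> (fact (Suc j) :: real)"
    by (rule fact_mono) simp
  ultimately have "fact j * 1 \<le> fact (Suc j) * pochhammer (p + 1) j"
    by (intro mult_mono) auto
  then have "1 / (fact (Suc j) * pochhammer (p + 1) j) \<le> 1 / fact j"
    using assms by (intro divide_left_mono mult_pos_pos pochhammer_pos) (auto simp del: fact_Suc)
  moreover have "0 \<le> 1 / (fact (Suc j) * pochhammer (p + 1) j)"
    using assms by (simp add: pochhammer_nonneg del: fact_Suc)
  ultimately show ?thesis
    unfolding fps_nth_hypergeo_1F2 by simp
qed

lemma conv_radius_hypergeo_1F2:
  assumes "0 < (p :: real)"
  shows "fps_conv_radius (fps_hypergeo [1] [2, p + 1] 1) = \<infinity>"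
  using abs_hypergeo_1F2_le[OF assms] by (rule fps_conv_radius_inftyI_fact)

text \<open>This is \<open>(a)_j / (a + 1)_j = a / (a + j)\<close>, multiplied out so that it also
  holds for \<open>a = 0\<close> and \<open>j = 0\<close>, where the quotient would be 0 /
  0.\<close>

lemma hypergeo_2F3_coeff:
  fixes p a :: real
  assumes "0 < p" "- 1 < a"
  shows "(a + real j) * fps_nth (fps_hypergeo [1, a] [2, p + 1, a + 1] 1) j
    = a * fps_nth (fps_hypergeo [1] [2, p + 1] 1) j"
proof -
  have "(a + real j) * pochhammer a j = a * pochhammer (a + 1) j"
    using pochhammer_rec[of a j] pochhammer_rec'[of a j] by simp
  moreover have "pochhammer (a + 1) j > 0"
    using assms by (intro pochhammer_pos) auto
  ultimately show ?thesis
    by (simp add: field_simps)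
qed

lemma conv_radius_hypergeo_2F3:
  fixes p a :: real
  assumes "0 < p" "- 1 < a"
  shows "fps_conv_radius (fps_hypergeo [1, a] [2, p + 1, a + 1] 1) = \<infinity>"
proof (rule fps_conv_radius_inftyI_fact)
  fix j
  let ?H = "fps_hypergeo [1, a] [2, p + 1, a + 1] 1"
  let ?B = "fps_hypergeo [1] [2, p + 1] 1"
  \<comment> \<open>The 1 covers the index 0; the quotient bounds \<open>|a| / (a + j)\<close> for
    \<open>j \<ge> 1\<close>, because then \<open>a + j \<ge> a + 1 > 0\<close>.\<close>
  define K where "K = 1 + \<bar>a\<bar> / (a + 1)"
  have K: "1 \<le> K" using assms by (simp add: K_def)
  have "\<bar>fps_nth ?H j\<bar> \<le> K * \<bar>fps_nth ?B j\<bar>"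
  proof (cases "j = 0")
    case True
    then show ?thesis using K by (simp del: fps_hypergeo_nth)
  next
    case False
    then have j: "a + 1 \<le> a + real j" by simp
    have "fps_nth ?H j = a / (a + real j) * fps_nth ?B j"
      using hypergeo_2F3_coeff[OF assms, of j] j assms by (simp add: field_simps del: fps_hypergeo_nth)
    then have "\<bar>fps_nth ?H j\<bar> = \<bar>a\<bar> / (a + real j) * \<bar>fps_nth ?B j\<bar>"
      using j assms by (simp add: abs_mult del: fps_hypergeo_nth)
    also have "\<dots> \<le> K * \<bar>fps_nth ?B j\<bar>"
    proof (rule mult_right_mono)
      have "\<bar>a\<bar> / (a + real j) \<le> \<bar>a\<bar> / (a + 1)"
        using j assms by (intro divide_left_mono) auto
      then show "\<bar>a\<bar> / (a + real j) \<le> K" by (simp add: K_def)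
    qed auto
    finally show ?thesis .
  qed
  also have "\<dots> \<le> K * (1 / fact j)"
    using abs_hypergeo_1F2_le[OF assms(1), of j] K by (intro mult_left_mono) auto
  finally show "\<bar>fps_nth ?H j\<bar> \<le> K / fact j" by simp
qed

section \<open>Differential and contiguous relations, read off the coefficients\<close>

lemma eval_fps_reflect_has_derivative:
  fixes F :: "real fps"
  assumes "fps_conv_radius F = \<infinity>"
  shows "((\<lambda>w. eval_fps F (- w)) has_real_derivative - eval_fps (fps_deriv F) (- w)) (at w)"
proof -
  have "(eval_fps F has_real_derivative eval_fps (fps_deriv F) (- w)) (at (- w))"
    by (rule has_field_derivative_eval_fps) (simp add: assms)
  moreover have "(uminus has_real_derivative - 1) (at w)"
    by (auto intro!: derivative_eq_intros)
  ultimately show ?thesis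
    using DERIV_chain2[where g = uminus and f = "eval_fps F"] by fastforce
qed

lemma eval_fps_const_mult:
  fixes F :: "real fps"
  assumes "fps_conv_radius F = \<infinity>"
  shows "eval_fps (fps_const c * F) z = c * eval_fps F z"
  using assms by (subst eval_fps_mult) auto

lemma eval_fps_X_mult:
  fixes F :: "real fps"
  assumes "fps_conv_radius F = \<infinity>"
  shows "eval_fps (fps_X * F) z = z * eval_fps F z"
  using assms by (subst eval_fps_mult) auto

lemma conv_radius_deriv_infty:
  fixes F :: "real fps"
  assumes "fps_conv_radius F = \<infinity>"
  shows "fps_conv_radius (fps_deriv F) = \<infinity>"
  using fps_conv_radius_deriv[of F] assms by auto

lemma conv_radius_diff_infty:
  fixes F :: "real fps"
  assumes "fps_conv_radius F = \<infinity>" "fps_conv_radius G = \<infinity>"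
  shows "fps_conv_radius (F - G) = \<infinity>"
  using fps_conv_radius_diff[of F G] assms by auto

lemma eval_deriv_hypergeo_0F1:
  assumes "0 < (p :: real)"
  shows "p * eval_fps (fps_deriv (fps_hypergeo [] [p] 1)) z = eval_fps (fps_hypergeo [] [p + 1] 1) z"
proof -
  have "fps_const p * fps_deriv (fps_hypergeo [] [p] 1) = fps_hypergeo [] [p + 1] 1"
  proof (rule fps_ext)
    fix j
    have "pochhammer p (Suc j) = p * pochhammer (p + 1) j" by (rule pochhammer_rec)
    moreover have "pochhammer (p + 1) j > 0" using assms by (intro pochhammer_pos) auto
    moreover have "fact (Suc j) = real (Suc j) * fact j" by (rule fact_Suc)
    ultimately show "fps_nth (fps_const p * fps_deriv (fps_hypergeo [] [p] 1)) j = fps_nth (fps_hypergeo [] [p + 1] 1) j"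
      using assms by (simp del: of_nat_Suc fact_Suc)
  qed
  then show ?thesis
    using conv_radius_hypergeo_0F1[OF assms] 
    by (metis eval_fps_const_mult conv_radius_deriv_infty)
qed

lemma hypergeo_0F1_reflect_has_derivative:
  assumes "0 < (p :: real)"
  shows "((\<lambda>w. eval_fps (fps_hypergeo [] [p] 1) (- w)) has_real_derivative
    - eval_fps (fps_hypergeo [] [p + 1] 1) (- w) / p) (at w)"
proof -
  have "- eval_fps (fps_deriv (fps_hypergeo [] [p] 1)) (- w) = - eval_fps (fps_hypergeo [] [p + 1] 1) (- w) / p"
    using eval_deriv_hypergeo_0F1[OF assms, of "- w"] assms by (simp add: eq_divide_eq mult.commute)
  then show ?thesis
    using eval_fps_reflect_has_derivative[OF conv_radius_hypergeo_0F1[OF assms], of w] by simp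
qed

text \<open>The operator \<open>z * d/dz\<close> multiplies the \<open>j\<close>-th coefficient by
  \<open>j\<close>, and \<open>p * (p + 1)_j = (p + j) * (p)_j\<close>. The relation supplies
  \<open>w * \<psi>' w\<close> in the energy argument.\<close>

lemma eval_deriv_hypergeo_0F1_contiguous:
  assumes "0 < (p :: real)"
  shows "z * eval_fps (fps_deriv (fps_hypergeo [] [p + 1] 1)) z
    = p * (eval_fps (fps_hypergeo [] [p] 1) z - eval_fps (fps_hypergeo [] [p + 1] 1) z)"
proof -
  let ?F = "\<lambda>p. fps_hypergeo [] [p] (1::real)"
  have radius: "fps_conv_radius (?F p) = \<infinity>" "fps_conv_radius (?F (p + 1)) = \<infinity>"
    using assms by (auto intro!: conv_radius_hypergeo_0F1)
  have "fps_X * fps_deriv (?F (p + 1)) = fps_const p * (?F p - ?F (p + 1))"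
  proof (rule fps_ext)
    fix j
    have "p * pochhammer (p + 1) j = (p + real j) * pochhammer p j"
      by (metis pochhammer_rec pochhammer_rec')
    moreover have "pochhammer (p + 1) j > 0" "pochhammer p j > 0"
      using assms by (auto intro!: pochhammer_pos)
    ultimately have "real j * fps_nth (?F (p + 1)) j = p * (fps_nth (?F p) j - fps_nth (?F (p + 1)) j)"
      by (simp add: field_simps)
    then show "fps_nth (fps_X * fps_deriv (?F (p + 1))) j = fps_nth (fps_const p * (?F p - ?F (p + 1))) j"
      by (cases j) (simp_all del: fps_hypergeo_nth of_nat_Suc)
  qed
  then have "eval_fps (fps_X * fps_deriv (?F (p + 1))) z = eval_fps (fps_const p * (?F p - ?F (p + 1))) z"
    by simp
  then show ?thesis
    using radius by (simp add: eval_fps_X_mult eval_fps_const_mult conv_radius_deriv_infty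
        conv_radius_diff_infty eval_fps_diff)
qed

text \<open>Removing the constant term of 0F1 and shifting the index by one produces 1F2 up to the
  factor \<open>p\<close>. Bounds for 0F1 thereby become bounds for 1F2.\<close>

lemma eval_hypergeo_1F2:
  assumes "0 < (p :: real)"
  shows "z * eval_fps (fps_hypergeo [1] [2, p + 1] 1) z = p * (eval_fps (fps_hypergeo [] [p] 1) z - 1)"
proof -
  let ?F = "fps_hypergeo [] [p] (1::real)"
  let ?B = "fps_hypergeo [1] [2, p + 1] (1::real)"
  have radius: "fps_conv_radius ?F = \<infinity>" "fps_conv_radius ?B = \<infinity>"
    using assms by (auto intro!: conv_radius_hypergeo_0F1 conv_radius_hypergeo_1F2)
  have "fps_X * ?B = fps_const p * (?F - 1)"
  proof (rule fps_ext)
    fix j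
    show "fps_nth (fps_X * ?B) j = fps_nth (fps_const p * (?F - 1)) j"
    proof (cases j)
      case (Suc i)
      have "fps_nth ?B i = p * fps_nth ?F (Suc i)"
        unfolding fps_nth_hypergeo_1F2 using assms by (simp add: pochhammer_rec field_simps del: fact_Suc)
      then show ?thesis by (simp add: Suc del: fps_hypergeo_nth)
    qed (simp del: fps_hypergeo_nth)
  qed
  then have "eval_fps (fps_X * ?B) z = eval_fps (fps_const p * (?F - 1)) z" by simp
  then show ?thesis
    using radius by (simp add: eval_fps_X_mult eval_fps_const_mult
        conv_radius_diff_infty eval_fps_diff)
qed

text \<open>Since \<open>z * d/dz\<close> multiplies the \<open>j\<close>-th coefficient by
  \<open>j\<close>, \<open>hypergeo_2F3_coeff\<close> turns into a first-order linear equation for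
  2F3 with 1F2 as source term.\<close>

lemma eval_deriv_hypergeo_2F3:
  fixes p a :: real
  assumes "0 < p" "- 1 < a"
  shows "z * eval_fps (fps_deriv (fps_hypergeo [1, a] [2, p + 1, a + 1] 1)) z
    = a * (eval_fps (fps_hypergeo [1] [2, p + 1] 1) z
           - eval_fps (fps_hypergeo [1, a] [2, p + 1, a + 1] 1) z)"
proof -
  let ?H = "fps_hypergeo [1, a] [2, p + 1, a + 1] (1::real)"
  let ?B = "fps_hypergeo [1] [2, p + 1] (1::real)"
  have radius: "fps_conv_radius ?H = \<infinity>" "fps_conv_radius ?B = \<infinity>"
    using assms by (auto intro!: conv_radius_hypergeo_2F3 conv_radius_hypergeo_1F2)
  have "fps_X * fps_deriv ?H = fps_const a * (?B - ?H)"
  proof (rule fps_ext)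
    fix j
    have "real j * fps_nth ?H j = a * (fps_nth ?B j - fps_nth ?H j)"
      using hypergeo_2F3_coeff[OF assms, of j] by (simp add: algebra_simps del: fps_hypergeo_nth)
    then show "fps_nth (fps_X * fps_deriv ?H) j = fps_nth (fps_const a * (?B - ?H)) j"
      by (cases j) (simp_all del: fps_hypergeo_nth of_nat_Suc)
  qed
  then have "eval_fps (fps_X * fps_deriv ?H) z = eval_fps (fps_const a * (?B - ?H)) z" by simp
  then show ?thesis
    using radius by (simp add: eval_fps_X_mult eval_fps_const_mult conv_radius_deriv_infty
        conv_radius_diff_infty eval_fps_diff)
qed

section \<open>Bounds for the 0F1 and 1F2 functions\<close>

text \<open>
  With \<open>\<phi> w = \<^sub>0F\<^sub>1(; p; -w)\<close> and \<open>\<psi> w = \<^sub>0F\<^sub>1(; p + 1; -w)\<close> the energy \<open>\<phi>\<^sup>2 + w \<psi>\<^sup>2 / p\<^sup>2\<close> has derivative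
  \<open>(1 - 2 p) \<psi>\<^sup>2 / p\<^sup>2\<close>.
\<close>

lemma abs_hypergeo_0F1_le_1:
  assumes "1 / 2 \<le> (p :: real)" "0 \<le> w"
  shows "\<bar>eval_fps (fps_hypergeo [] [p] 1) (- w)\<bar> \<le> 1"
proof -
  define \<phi> where "\<phi> = (\<lambda>w. eval_fps (fps_hypergeo [] [p] 1) (- w))"
  define \<psi> where "\<psi> = (\<lambda>w. eval_fps (fps_hypergeo [] [p + 1] 1) (- w))"
  define \<psi>' where "\<psi>' = (\<lambda>w. - eval_fps (fps_deriv (fps_hypergeo [] [p + 1] 1)) (- w))"
  define E where "E = (\<lambda>w. (\<phi> w)\<^sup>2 + w * (\<psi> w)\<^sup>2 / p\<^sup>2)"
  have p: "0 < p" using assms by simp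
  have d\<phi>: "(\<phi> has_real_derivative - \<psi> w / p) (at w)" for w
    unfolding \<phi>_def \<psi>_def by (rule hypergeo_0F1_reflect_has_derivative[OF p])
  have d\<psi>: "(\<psi> has_real_derivative \<psi>' w) (at w)" for w
    unfolding \<psi>_def \<psi>'_def using p
    by (intro eval_fps_reflect_has_derivative conv_radius_hypergeo_0F1) auto
  have w\<psi>': "w * \<psi>' w = p * (\<phi> w - \<psi> w)" for w
    using eval_deriv_hypergeo_0F1_contiguous[OF p, of "- w"] by (simp add: \<phi>_def \<psi>_def \<psi>'_def)
  have dE: "(E has_real_derivative (1 - 2 * p) * (\<psi> w)\<^sup>2 / p\<^sup>2) (at w)" for w
  proof -
    have "(E has_real_derivative
        2 * \<phi> w * (- \<psi> w / p) + ((\<psi> w)\<^sup>2 + 2 * \<psi> w * (w * \<psi>' w)) / p\<^sup>2) (at w)"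
      unfolding E_def using p by (auto intro!: derivative_eq_intros d\<phi> d\<psi> simp: field_simps power2_eq_square)
    \<comment> \<open>After inserting the contiguous relation, the mixed terms
      \<open>\<phi> w * \<psi> w\<close> cancel.\<close>
    also have "2 * \<phi> w * (- \<psi> w / p) + ((\<psi> w)\<^sup>2 + 2 * \<psi> w * (w * \<psi>' w)) / p\<^sup>2
        = (1 - 2 * p) * (\<psi> w)\<^sup>2 / p\<^sup>2"
      unfolding w\<psi>' using p by (simp add: field_simps power2_eq_square)
    finally show ?thesis .
  qed
  have "E w \<le> E 0"
    using assms(2)
  proof (rule DERIV_nonpos_imp_nonincreasing)
    fix x
    \<comment> \<open>Here \<open>p \<ge> 1 / 2\<close> enters: the energy does not increase, so
      \<open>E 0 = 1\<close> bounds the square of \<open>\<phi>\<close>.\<close>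
    have "(1 - 2 * p) * (\<psi> x)\<^sup>2 / p\<^sup>2 \<le> 0"
      using assms by (intro divide_nonpos_nonneg mult_nonpos_nonneg) auto
    with dE show "\<exists>y. (E has_real_derivative y) (at x) \<and> y \<le> 0" by blast
  qed
  moreover have "E 0 = 1"
    by (simp add: E_def \<phi>_def eval_fps_at_0 del: fps_hypergeo_nth)
  moreover have "(\<phi> w)\<^sup>2 \<le> E w" using assms by (simp add: E_def)
  ultimately have "(\<phi> w)\<^sup>2 \<le> 1" by simp
  then show ?thesis by (simp add: \<phi>_def abs_square_le_1)
qed

text \<open>After adding \<open>w / p\<close> the derivative is \<open>(1 - \<psi> w) / p\<close>,
  which is nonnegative by \<open>abs_hypergeo_0F1_le_1\<close> at the parameter
  \<open>p + 1\<close>.\<close>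

lemma hypergeo_0F1_ge:
  assumes "1 / 2 \<le> (p :: real)" "0 \<le> w"
  shows "1 - w / p \<le> eval_fps (fps_hypergeo [] [p] 1) (- w)"
proof -
  define g where "g = (\<lambda>w. eval_fps (fps_hypergeo [] [p] 1) (- w) + w / p)"
  have p: "0 < p" using assms by simp
  have "g 0 \<le> g w" using assms(2)
  proof (rule DERIV_nonneg_imp_nondecreasing)
    fix x :: real assume "0 \<le> x"
    let ?y = "- eval_fps (fps_hypergeo [] [p + 1] 1) (- x) / p + 1 / p"
    have "\<bar>eval_fps (fps_hypergeo [] [p + 1] 1) (- x)\<bar> \<le> 1"
      using assms \<open>0 \<le> x\<close> by (intro abs_hypergeo_0F1_le_1) auto
    then have "0 \<le> ?y" using p by (simp add: field_simps)
    moreover have "(g has_real_derivative ?y) (at x)"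
      unfolding g_def using p
      by (auto intro!: derivative_eq_intros hypergeo_0F1_reflect_has_derivative[OF p])
    ultimately show "\<exists>y. (g has_real_derivative y) (at x) \<and> 0 \<le> y" by blast
  qed
  then show ?thesis by (simp add: g_def eval_fps_at_0 del: fps_hypergeo_nth)
qed

text \<open>In \<open>w * \<Phi> w = p * (1 - \<phi> w)\<close>, \<open>\<phi> w \<le> 1\<close>
  gives the lower bound and \<open>\<phi> w \<ge> 1 - w / p\<close> the upper one.\<close>

lemma hypergeo_1F2_bounds:
  assumes "1 / 2 \<le> (p :: real)" "0 < w"
  shows "0 \<le> eval_fps (fps_hypergeo [1] [2, p + 1] 1) (- w)"
    and "eval_fps (fps_hypergeo [1] [2, p + 1] 1) (- w) \<le> 1"
proof -
  let ?B = "eval_fps (fps_hypergeo [1] [2, p + 1] 1) (- w)"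
  let ?\<phi> = "eval_fps (fps_hypergeo [] [p] 1) (- w)"
  have p: "0 < p" using assms by simp
  have B: "w * ?B = p * (1 - ?\<phi>)"
    using eval_hypergeo_1F2[OF p, of "- w"] by (simp add: algebra_simps)
  have "0 \<le> w * ?B"
    unfolding B using abs_hypergeo_0F1_le_1[of p w] assms p by (intro mult_nonneg_nonneg) auto
  then show "0 \<le> ?B" using assms by (simp add: zero_le_mult_iff)
  have "p * (1 - ?\<phi>) \<le> p * (w / p)"
    using hypergeo_0F1_ge[of p w] assms p by (intro mult_left_mono) auto
  then have "w * ?B \<le> w * 1" using B p by simp
  then show "?B \<le> 1" using assms(2) by simp
qed

section \<open>Monotone quantities built from the 2F3 function\<close>

lemma hypergeo_2F3_reflect_has_derivative:
  fixes p a :: real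
  assumes "0 < p" "- 1 < a" "w \<noteq> 0"
  shows "((\<lambda>w. eval_fps (fps_hypergeo [1, a] [2, p + 1, a + 1] 1) (- w)) has_real_derivative
    a * (eval_fps (fps_hypergeo [1] [2, p + 1] 1) (- w)
         - eval_fps (fps_hypergeo [1, a] [2, p + 1, a + 1] 1) (- w)) / w) (at w)"
proof -
  let ?H = "fps_hypergeo [1, a] [2, p + 1, a + 1] (1::real)"
  let ?B = "fps_hypergeo [1] [2, p + 1] (1::real)"
  have "- eval_fps (fps_deriv ?H) (- w) = a * (eval_fps ?B (- w) - eval_fps ?H (- w)) / w"
    using eval_deriv_hypergeo_2F3[OF assms(1,2), of "- w"] assms(3)
    by (simp add: eq_divide_eq mult.commute)
  then show ?thesis
    using eval_fps_reflect_has_derivative[OF conv_radius_hypergeo_2F3[OF assms(1,2)], of w] by simp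
qed

text \<open>
  The differential equation \<open>w G' = a (\<Phi> - G)\<close> becomes \<open>(w powr a * (G - c))' = a w powr (a - 1) (\<Phi> - c)\<close>.
\<close>

lemma powr_mult_hypergeo_2F3_has_derivative:
  fixes p a c :: real
  assumes "0 < p" "- 1 < a" "0 < w"
  shows "((\<lambda>w. w powr a * (eval_fps (fps_hypergeo [1, a] [2, p + 1, a + 1] 1) (- w) - c))
    has_real_derivative
    a * w powr (a - 1) * (eval_fps (fps_hypergeo [1] [2, p + 1] 1) (- w) - c)) (at w)"
proof -
  let ?G = "eval_fps (fps_hypergeo [1, a] [2, p + 1, a + 1] (1::real)) (- w)"
  let ?\<Phi> = "eval_fps (fps_hypergeo [1] [2, p + 1] (1::real)) (- w)"
  have "((\<lambda>w. w powr a * (eval_fps (fps_hypergeo [1, a] [2, p + 1, a + 1] 1) (- w) - c))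
    has_real_derivative w powr a * (a * (?\<Phi> - ?G) / w) + a * w powr (a - 1) * (?G - c)) (at w)"
    using assms
    by (auto intro!: derivative_eq_intros hypergeo_2F3_reflect_has_derivative has_real_derivative_powr)
  also have "w powr a = w * w powr (a - 1)"
    using assms by (simp add: powr_mult_base)
  also have "w * w powr (a - 1) * (a * (?\<Phi> - ?G) / w) + a * w powr (a - 1) * (?G - c)
      = a * w powr (a - 1) * (?\<Phi> - c)"
    using assms by (simp add: field_simps)
  finally show ?thesis .
qed

text \<open>Since \<open>\<Phi>\<close> takes values in [0, 1], \<open>sign\<close> makes the
  derivative nonnegative. It holds with \<open>c = 0\<close> for \<open>a > 0\<close> and with
  \<open>c = 1\<close> for \<open>a < 0\<close>.\<close>

lemma powr_mult_hypergeo_2F3_mono: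
  fixes p a c :: real
  assumes "1 / 2 \<le> p" "- 1 < a" "0 < v" "v \<le> w"
    and sign: "\<And>x. 0 \<le> x \<Longrightarrow> x \<le> 1 \<Longrightarrow> 0 \<le> a * (x - c)"
  shows "v powr a * (eval_fps (fps_hypergeo [1, a] [2, p + 1, a + 1] 1) (- v) - c)
    \<le> w powr a * (eval_fps (fps_hypergeo [1, a] [2, p + 1, a + 1] 1) (- w) - c)"
  using assms(4)
proof (rule DERIV_nonneg_imp_nondecreasing)
  fix x assume "v \<le> x" "x \<le> w"
  then have x: "0 < x" using assms(3) by simp
  let ?\<Phi> = "eval_fps (fps_hypergeo [1] [2, p + 1] (1::real)) (- x)"
  have "0 \<le> x powr (a - 1) * (a * (?\<Phi> - c))"
    using hypergeo_1F2_bounds[OF assms(1) x] by (intro mult_nonneg_nonneg sign) auto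
  also have "\<dots> = a * x powr (a - 1) * (?\<Phi> - c)" by simp
  finally show "\<exists>y. ((\<lambda>w. w powr a * (eval_fps (fps_hypergeo [1, a] [2, p + 1, a + 1] 1) (- w) - c))
      has_real_derivative y) (at x) \<and> 0 \<le> y"
    using powr_mult_hypergeo_2F3_has_derivative[OF _ assms(2) x, of p c] assms(1) by auto
qed

section \<open>Sign and growth of the 2F3 function\<close>

lemma hypergeo_2F3_at_0:
  "eval_fps (fps_hypergeo [1, a] [2, p + 1, a + 1] (1::real)) (- 0) = 1"
  by (simp add: eval_fps_at_0 del: fps_hypergeo_nth)

lemma hypergeo_2F3_reflect_continuous:
  fixes p a :: real
  assumes "0 < p" "- 1 < a"
  shows "continuous_on A (\<lambda>w. eval_fps (fps_hypergeo [1, a] [2, p + 1, a + 1] 1) (- w))"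
  by (rule DERIV_continuous_on)
    (rule eval_fps_reflect_has_derivative[OF conv_radius_hypergeo_2F3[OF assms], THEN has_field_derivative_at_within])

text \<open>This provides a starting point for the monotonicity on \<open>w > 0\<close>, by
  continuity and the value 1 at 0.\<close>

lemma hypergeo_2F3_pos_near_0:
  fixes p a :: real
  assumes "0 < p" "- 1 < a" "0 < w"
  obtains v where "0 < v" "v \<le> w" "0 < eval_fps (fps_hypergeo [1, a] [2, p + 1, a + 1] 1) (- v)"
proof -
  let ?G = "\<lambda>w. eval_fps (fps_hypergeo [1, a] [2, p + 1, a + 1] 1) (- w)"
  have "isCont ?G 0"
    using hypergeo_2F3_reflect_continuous[OF assms(1,2), of UNIV]
    by (simp add: continuous_on_eq_continuous_at)
  then have "(?G \<longlongrightarrow> 1) (at 0)"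
    by (simp add: isCont_def eval_fps_at_0 del: fps_hypergeo_nth)
  then have "\<forall>\<^sub>F v in at 0. 0 < ?G v"
    by (rule order_tendstoD) simp
  then obtain d where d: "0 < d" "\<And>v. v \<noteq> 0 \<Longrightarrow> dist v 0 < d \<Longrightarrow> 0 < ?G v"
    unfolding eventually_at by blast
  show ?thesis
    using assms d(1) by (intro that[of "min w (d / 2)"] d(2)) auto
qed

text \<open>The monotone quantity with \<open>c = 1\<close> needs a starting point where the
  function is at least 1. Continuity at 0 does not give one, but the positive slope there
  does.\<close>

lemma hypergeo_2F3_ge_1_if_neg:
  fixes p a :: real
  assumes "1 / 2 \<le> p" "- 1 < a" "a < 0" "0 \<le> w"
  shows "1 \<le> eval_fps (fps_hypergeo [1, a] [2, p + 1, a + 1] 1) (- w)"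
proof (cases "w = 0")
  case True
  then show ?thesis using hypergeo_2F3_at_0[of a p] by simp
next
  case False
  let ?H = "fps_hypergeo [1, a] [2, p + 1, a + 1] (1::real)"
  have p: "0 < p" and w: "0 < w" using assms False by auto
  \<comment> \<open>The linear coefficient of the series is
    \<open>a / ((a + 1) * (2 * (p + 1)))\<close>, negative for this \<open>a\<close>; the reflection
    flips its sign.\<close>
  have "0 < - (a / ((a + 1) * (2 * (p + 1))))"
    using assms p by (simp add: divide_neg_pos)
  also have "\<dots> = - eval_fps (fps_deriv ?H) (- 0)"
    by (simp add: eval_fps_at_0 mult_ac)
  finally have "0 < - eval_fps (fps_deriv ?H) (- 0)" .
  then obtain d where d: "0 < d" "\<And>h. 0 < h \<Longrightarrow> h < d \<Longrightarrow> eval_fps ?H (- 0) < eval_fps ?H (- (0 + h))"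
    using DERIV_pos_inc_right[OF eval_fps_reflect_has_derivative[OF conv_radius_hypergeo_2F3[OF p assms(2)], of 0]]
    by blast
  define v where "v = min w (d / 2)"
  have v: "0 < v" "v \<le> w" "v < d" using d(1) w by (auto simp: v_def)
  have "1 < eval_fps ?H (- v)"
    using d(2)[of v] v hypergeo_2F3_at_0[of a p] by simp
  then have "0 \<le> v powr a * (eval_fps ?H (- v) - 1)" by simp
  also have "\<dots> \<le> w powr a * (eval_fps ?H (- w) - 1)"
    using assms v by (intro powr_mult_hypergeo_2F3_mono) (auto intro: mult_nonpos_nonpos)
  finally show ?thesis
    using w by (simp add: zero_le_mult_iff)
qed

text \<open>This is the case \<open>\<beta> = n + 2\<close>: \<open>pochhammer 0 j\<close> vanishes
  for \<open>j \<ge> 1\<close>, which leaves the constant term and the multiplier of the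
  Laplacian.\<close>

lemma hypergeo_2F3_eq_1:
  assumes "0 < (p :: real)"
  shows "eval_fps (fps_hypergeo [1, 0] [2, p + 1, 0 + 1] (1::real)) z = 1"
proof -
  have "fps_hypergeo [1, 0] [2, p + 1, 0 + 1] (1::real) = 1"
    by (rule fps_ext) (auto simp: pochhammer_0_left)
  then show ?thesis by simp
qed

lemma hypergeo_2F3_pos:
  fixes p a :: real
  assumes "1 / 2 \<le> p" "- 1 < a" "0 \<le> w"
  shows "0 < eval_fps (fps_hypergeo [1, a] [2, p + 1, a + 1] 1) (- w)"
proof -
  let ?G = "\<lambda>w. eval_fps (fps_hypergeo [1, a] [2, p + 1, a + 1] 1) (- w)"
  have p: "0 < p" using assms by simp
  consider "w = 0" | "a < 0" | "a = 0" | "0 < w" "0 < a" using assms by linarith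
  then show ?thesis
  proof cases
    case 1
    then show ?thesis using hypergeo_2F3_at_0[of a p] by simp
  next
    case 2
    then show ?thesis using hypergeo_2F3_ge_1_if_neg[OF assms(1,2) _ assms(3)] by simp
  next
    case 3
    then show ?thesis using hypergeo_2F3_eq_1[OF p] by simp
  next
    case 4
    obtain v where v: "0 < v" "v \<le> w" "0 < ?G v"
      using hypergeo_2F3_pos_near_0[OF p assms(2) 4(1)] by blast
    have "0 < v powr a * (?G v - 0)" using v by simp
    also have "\<dots> \<le> w powr a * (?G w - 0)"
      using assms 4 v by (intro powr_mult_hypergeo_2F3_mono) auto
    finally show ?thesis using 4 by (simp add: zero_less_mult_iff)
  qed
qed

lemma hypergeo_2F3_upper:
  fixes p a :: real
  assumes "1 / 2 \<le> p" "- 1 < a"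
  obtains C where "0 \<le> C"
    "\<And>w. 0 \<le> w \<Longrightarrow> eval_fps (fps_hypergeo [1, a] [2, p + 1, a + 1] 1) (- w) \<le> C * (1 + w)"
proof -
  let ?G = "\<lambda>w. eval_fps (fps_hypergeo [1, a] [2, p + 1, a + 1] 1) (- w)"
  have p: "0 < p" using assms by simp
  have "compact (?G ` {0..1})"
    by (intro compact_continuous_image hypergeo_2F3_reflect_continuous p assms(2) compact_Icc)
  then obtain M where "\<forall>w\<in>{0..1}. \<bar>?G w\<bar> \<le> M"
    by (auto dest!: compact_imp_bounded simp: bounded_iff)
  then have M: "\<bar>?G w\<bar> \<le> M" if "0 \<le> w" "w \<le> 1" for w
    using that by simp
  have M0: "0 \<le> M" using M[of 0] by simp
  have "?G w \<le> (1 + M) * (1 + w)" if w: "0 \<le> w" for w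
  proof -
    consider "w \<le> 1" | "1 \<le> w" "0 \<le> a" | "1 \<le> w" "a < 0" by linarith
    then show ?thesis
    proof cases
      case 1
      then have "?G w \<le> M * 1" using M[OF w] by simp
      also have "\<dots> \<le> (1 + M) * (1 + w)" using M0 w by (intro mult_mono) auto
      finally show ?thesis .
    next
      \<comment> \<open>With \<open>c = 1\<close> the derivative is nonpositive for
        \<open>a \<ge> 0\<close>, so \<open>w powr a * (G w - 1)\<close> stays below its value at 1
        and \<open>G\<close> is bounded by \<open>1 + M\<close>.\<close>
      case 2
      have "?G w \<le> 1 + M"
      proof (cases "a = 0")
        case True
        then show ?thesis using hypergeo_2F3_eq_1[OF p] M0 by simp
      next
        case False
        have "w powr a * (?G w - 1) \<le> 1 powr a * (?G 1 - 1)"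
        proof (rule DERIV_nonpos_imp_nonincreasing[OF 2(1)])
          fix x :: real assume "1 \<le> x"
          then have x: "0 < x" by simp
          let ?\<Phi> = "eval_fps (fps_hypergeo [1] [2, p + 1] (1::real)) (- x)"
          have "a * x powr (a - 1) * (?\<Phi> - 1) \<le> 0"
            using hypergeo_1F2_bounds[OF assms(1) x] 2(2) by (intro mult_nonneg_nonpos) auto
          then show "\<exists>y. ((\<lambda>w. w powr a * (?G w - 1)) has_real_derivative y) (at x) \<and> y \<le> 0"
            using powr_mult_hypergeo_2F3_has_derivative[OF p assms(2) x, of 1] by blast
        qed
        also have "\<dots> \<le> 1 * M" using M[of 1] by simp
        also have "\<dots> \<le> w powr a * M" using M0 2 by (intro mult_right_mono) (auto simp: ge_one_powr_ge_zero)
        finally show ?thesis using 2 by simp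
      qed
      also have "\<dots> \<le> (1 + M) * (1 + w)" using M0 w by simp
      finally show ?thesis .
    next
      \<comment> \<open>With \<open>c = 0\<close> the quantity decreases for \<open>a < 0\<close>,
        so \<open>G w \<le> M * w powr (- a)\<close>; \<open>a > -1\<close> makes this at most
        linear.\<close>
      case 3
      have "w powr a * (?G w - 0) \<le> 1 powr a * (?G 1 - 0)"
      proof (rule DERIV_nonpos_imp_nonincreasing[OF 3(1)])
        fix x :: real assume "1 \<le> x"
        then have x: "0 < x" by simp
        let ?\<Phi> = "eval_fps (fps_hypergeo [1] [2, p + 1] (1::real)) (- x)"
        have "a * x powr (a - 1) * (?\<Phi> - 0) \<le> 0"
          using hypergeo_1F2_bounds[OF assms(1) x] 3(2) by (intro mult_nonpos_nonneg) auto
        then show "\<exists>y. ((\<lambda>w. w powr a * (?G w - 0)) has_real_derivative y) (at x) \<and> y \<le> 0"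
          using powr_mult_hypergeo_2F3_has_derivative[OF p assms(2) x, of 0] by blast
      qed
      also have "\<dots> \<le> M" using M[of 1] by simp
      finally have "w powr a * ?G w \<le> M" by simp
      then have "w powr (- a) * (w powr a * ?G w) \<le> w powr (- a) * M"
        by (intro mult_left_mono) auto
      also have "w powr (- a) * (w powr a * ?G w) = ?G w"
        using 3 by (simp add: mult.assoc[symmetric] powr_add[symmetric])
      also have "w powr (- a) * M \<le> w powr 1 * M"
        using 3 assms M0 by (intro mult_right_mono powr_mono) auto
      also have "\<dots> \<le> (1 + M) * (1 + w)" using 3 M0 by (simp add: algebra_simps)
      finally show ?thesis .
    qed
  qed
  with M0 show ?thesis by (intro that[of "1 + M"]) auto
qed

text \<open>For \<open>a > 0\<close> the monotone quantity with \<open>c = 0\<close> gives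
  \<open>w * G w \<ge> G 1 * w powr (1 - a)\<close>, a positive power as \<open>a < 1\<close>. For
  \<open>a \<le> 0\<close> already \<open>G w \<ge> 1\<close>.\<close>

lemma hypergeo_2F3_lower:
  fixes p a :: real
  assumes "1 / 2 \<le> p" "- 1 < a" "a < 1"
  obtains c \<epsilon> where "0 < c" "0 < \<epsilon>"
    "\<And>w. 1 \<le> w \<Longrightarrow> c * w powr \<epsilon> \<le> w * eval_fps (fps_hypergeo [1, a] [2, p + 1, a + 1] 1) (- w)"
proof -
  let ?G = "\<lambda>w. eval_fps (fps_hypergeo [1, a] [2, p + 1, a + 1] 1) (- w)"
  have p: "0 < p" using assms by simp
  show ?thesis
  proof (cases "0 < a")
    case True
    have "?G 1 * w powr (1 - a) \<le> w * ?G w" if "1 \<le> w" for w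
    proof -
      have "1 powr a * (?G 1 - 0) \<le> w powr a * (?G w - 0)"
        using assms True that by (intro powr_mult_hypergeo_2F3_mono) auto
      then have "w powr (1 - a) * ?G 1 \<le> w powr (1 - a) * (w powr a * ?G w)"
        by (intro mult_left_mono) auto
      also have "\<dots> = w * ?G w"
        using that by (simp add: mult.assoc[symmetric] powr_add[symmetric])
      finally show ?thesis by (simp add: mult.commute)
    qed
    with assms True show ?thesis
      by (intro that[of "?G 1" "1 - a"] hypergeo_2F3_pos) auto
  next
    case False
    have "1 * w powr 1 \<le> w * ?G w" if "1 \<le> w" for w
    proof -
      have "1 \<le> ?G w"
        using hypergeo_2F3_ge_1_if_neg[OF assms(1,2), of w] hypergeo_2F3_eq_1[OF p, of "- w"] False that
        by (cases "a = 0") auto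
      with that show ?thesis by simp
    qed
    then show ?thesis by (rule that[rotated 2]) auto
  qed
qed

section \<open>Bounds for the multiplier\<close>

lemma hypergeo_argument:
  "- (1 / 4) * (norm \<nu>)\<^sup>2 * \<delta>\<^sup>2 = - (\<delta>\<^sup>2 / 4 * (norm (\<nu> :: real ^ 'n::finite))\<^sup>2)"
  by simp

text \<open>The prefactor is rewritten through \<open>w\<close> as well, so that bounds in the
  single variable \<open>w \<ge> 0\<close> carry over to the multiplier.\<close>

lemma multiplier_eq:
  fixes \<nu> :: "real ^ 'n::finite"
  assumes "p = real CARD('n) / 2" "a = (real CARD('n) + 2 - \<beta>) / 2" "w = \<delta>\<^sup>2 / 4 * (norm \<nu>)\<^sup>2" "0 < \<delta>"
  shows "multiplier \<delta> \<beta> \<nu> = - (4 / \<delta>\<^sup>2) * (w * eval_fps (fps_hypergeo [1, a] [2, p + 1, a + 1] 1) (- w))"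
proof -
  have params: "(real CARD('n) + 2) / 2 = p + 1" "(real CARD('n) + 4 - \<beta>) / 2 = a + 1"
    using assms by (simp_all add: field_simps)
  have "(norm \<nu>)\<^sup>2 = 4 / \<delta>\<^sup>2 * w" using assms(4) by (simp add: assms(3))
  then show ?thesis
    unfolding multiplier_def Let_def params assms(2)[symmetric] hypergeo_argument assms(3)[symmetric]
    by simp
qed

text \<open>Dimension at least 1 puts \<open>p = n / 2\<close> in the range of the energy
  argument.\<close>

lemma half_card_ge: "1 / 2 \<le> real CARD('n::finite) / 2"
  by (simp add: Suc_leI)

lemma multiplier_nonpos:
  fixes \<nu> :: "real ^ 'n::finite"
  assumes "0 < \<delta>" "\<beta> < real CARD('n) + 4"
  shows "multiplier \<delta> \<beta> \<nu> \<le> 0"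
proof -
  define w where "w = \<delta>\<^sup>2 / 4 * (norm \<nu>)\<^sup>2"
  have w: "0 \<le> w" by (simp add: w_def)
  have a: "- 1 < (real CARD('n) + 2 - \<beta>) / 2" using assms by (simp add: field_simps)
  from hypergeo_2F3_pos[OF half_card_ge[where 'n = 'n] a w] w show ?thesis
    unfolding multiplier_eq[OF refl refl w_def assms(1)] by (intro mult_nonpos_nonneg) auto
qed

text \<open>The factor \<open>w\<close> and the linear bound for the 2F3 function contribute one
  power of \<open>1 + w\<close> each.\<close>

lemma multiplier_growth:
  assumes "0 < \<delta>" "\<beta> < real CARD('n) + 4"
  obtains C where "0 \<le> C" "\<And>\<nu> :: real ^ 'n::finite. \<bar>multiplier \<delta> \<beta> \<nu>\<bar> \<le> C * (1 + (norm \<nu>)\<^sup>2)\<^sup>2"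
proof -
  let ?G = "\<lambda>w. eval_fps (fps_hypergeo [1, (real CARD('n) + 2 - \<beta>) / 2]
    [2, real CARD('n) / 2 + 1, (real CARD('n) + 2 - \<beta>) / 2 + 1] 1) (- w)"
  have a: "- 1 < (real CARD('n) + 2 - \<beta>) / 2" using assms by (simp add: field_simps)
  obtain C where C: "0 \<le> C" "\<And>w. 0 \<le> w \<Longrightarrow> ?G w \<le> C * (1 + w)"
    using hypergeo_2F3_upper[OF half_card_ge[where 'n = 'n] a] by blast
  define D where "D = 1 + \<delta>\<^sup>2 / 4"
  have "\<bar>multiplier \<delta> \<beta> \<nu>\<bar> \<le> (4 / \<delta>\<^sup>2 * C * D\<^sup>2) * (1 + (norm \<nu>)\<^sup>2)\<^sup>2" for \<nu> :: "real ^ 'n"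
  proof -
    define w where "w = \<delta>\<^sup>2 / 4 * (norm \<nu>)\<^sup>2"
    have w: "0 \<le> w" by (simp add: w_def)
    have "1 + d * x \<le> (1 + d) * (1 + x)" if "0 \<le> d" "0 \<le> x" for d x :: real
      using that by (simp add: algebra_simps)
    from this[of "\<delta>\<^sup>2 / 4" "(norm \<nu>)\<^sup>2"] have wD: "1 + w \<le> D * (1 + (norm \<nu>)\<^sup>2)"
      by (simp add: w_def D_def)
    have "\<bar>multiplier \<delta> \<beta> \<nu>\<bar> = 4 / \<delta>\<^sup>2 * (w * ?G w)"
      using multiplier_nonpos[OF assms, of \<nu>] multiplier_eq[OF refl refl w_def assms(1), of \<beta>] by linarith
    also have "\<dots> \<le> 4 / \<delta>\<^sup>2 * ((1 + w) * (C * (1 + w)))"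
      using C w hypergeo_2F3_pos[OF half_card_ge[where 'n = 'n] a w]
      by (intro mult_left_mono mult_mono less_imp_le[OF hypergeo_2F3_pos[OF half_card_ge[where 'n = 'n] a w]]) auto
    also have "\<dots> = 4 / \<delta>\<^sup>2 * C * (1 + w)\<^sup>2" by (simp add: power2_eq_square)
    also have "\<dots> \<le> 4 / \<delta>\<^sup>2 * C * (D * (1 + (norm \<nu>)\<^sup>2))\<^sup>2"
      using C w wD by (intro mult_left_mono power_mono) auto
    finally show ?thesis by (simp add: power_mult_distrib)
  qed
  then show ?thesis using C by (intro that[of "4 / \<delta>\<^sup>2 * C * D\<^sup>2"]) auto
qed

text \<open>The condition \<open>\<beta> > n\<close> is \<open>a < 1\<close>, under which
  \<open>hypergeo_2F3_lower\<close> applies. This decay is the source of the smoothing.\<close>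

lemma multiplier_decay:
  assumes "0 < \<delta>" "real CARD('n) < \<beta>" "\<beta> < real CARD('n) + 4"
  obtains c \<epsilon> where "0 < c" "0 < \<epsilon>"
    "\<And>\<nu> :: real ^ 'n::finite. 1 \<le> \<delta>\<^sup>2 / 4 * (norm \<nu>)\<^sup>2 \<Longrightarrow>
      multiplier \<delta> \<beta> \<nu> \<le> - c * (\<delta>\<^sup>2 / 4 * (norm \<nu>)\<^sup>2) powr \<epsilon>"
proof -
  let ?G = "\<lambda>w. eval_fps (fps_hypergeo [1, (real CARD('n) + 2 - \<beta>) / 2]
    [2, real CARD('n) / 2 + 1, (real CARD('n) + 2 - \<beta>) / 2 + 1] 1) (- w)"
  have a: "- 1 < (real CARD('n) + 2 - \<beta>) / 2" "(real CARD('n) + 2 - \<beta>) / 2 < 1"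
    using assms by (simp_all add: field_simps)
  obtain c \<epsilon> where c: "0 < c" "0 < \<epsilon>" "\<And>w. 1 \<le> w \<Longrightarrow> c * w powr \<epsilon> \<le> w * ?G w"
    using hypergeo_2F3_lower[OF half_card_ge[where 'n = 'n] a] by blast
  have "multiplier \<delta> \<beta> \<nu> \<le> - (4 / \<delta>\<^sup>2 * c) * w powr \<epsilon>"
    if "1 \<le> w" and w: "w = \<delta>\<^sup>2 / 4 * (norm \<nu>)\<^sup>2" for \<nu> :: "real ^ 'n" and w
  proof -
    have "4 / \<delta>\<^sup>2 * (c * w powr \<epsilon>) \<le> 4 / \<delta>\<^sup>2 * (w * ?G w)"
      using c(3)[OF that(1)] by (intro mult_left_mono) auto
    then show ?thesis unfolding multiplier_eq[OF refl refl w assms(1)] by simp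
  qed
  then show ?thesis using c assms(1) by (intro that[of "4 / \<delta>\<^sup>2 * c" \<epsilon>]) auto
qed

section \<open>Comparison of lattice indices and frequencies\<close>

lemma norm_diagonal_le:
  fixes x y :: "real ^ 'n::finite"
  assumes "\<And>i. \<bar>x $ i\<bar> \<le> C * \<bar>y $ i\<bar>" "0 \<le> C"
  shows "norm x \<le> C * norm y"
proof -
  have "norm x \<le> norm (C *\<^sub>R y)"
    using assms by (intro norm_le_componentwise_cart) (simp add: abs_mult)
  then show ?thesis using assms by simp
qed

lemma norm_frequency_le:
  fixes r :: "real ^ 'n::finite"
  assumes "\<And>i. 0 < r $ i"
  obtains C where "0 \<le> C" "\<And>k. norm (frequency r k) \<le> C * index_norm k"
proof -
  \<comment> \<open>A sum of positive terms dominates each of them, so one constant serves all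
    coordinates.\<close>
  define C where "C = (\<Sum>i\<in>UNIV. 2 * pi / r $ i)"
  have C0: "0 \<le> C" unfolding C_def using assms by (intro sum_nonneg) (auto intro: less_imp_le)
  have C: "2 * pi / r $ i \<le> C" for i
    unfolding C_def using assms by (intro member_le_sum) (auto intro: less_imp_le)
  have "norm (frequency r k) \<le> C * index_norm k" for k
    unfolding index_norm_def
  proof (rule norm_diagonal_le)
    fix i
    have "\<bar>frequency r k $ i\<bar> = 2 * pi / r $ i * \<bar>real_of_int (k $ i)\<bar>"
      using assms[of i] by (simp add: frequency_def abs_mult)
    also have "\<dots> \<le> C * \<bar>real_of_int (k $ i)\<bar>" by (intro mult_right_mono C) auto
    finally show "\<bar>frequency r k $ i\<bar> \<le> C * \<bar>(\<chi> i. real_of_int (k $ i)) $ i\<bar>" by simp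
  qed (rule C0)
  with C0 show ?thesis by (rule that)
qed

lemma index_norm_le:
  fixes r :: "real ^ 'n::finite"
  assumes "\<And>i. 0 < r $ i"
  obtains C where "0 \<le> C" "\<And>k. index_norm k \<le> C * norm (frequency r k)"
proof -
  define C where "C = (\<Sum>i\<in>UNIV. r $ i / (2 * pi))"
  have C0: "0 \<le> C" unfolding C_def using assms by (intro sum_nonneg) (auto intro: less_imp_le)
  have C: "r $ i / (2 * pi) \<le> C" for i
    unfolding C_def using assms by (intro member_le_sum) (auto intro: less_imp_le)
  have "index_norm k \<le> C * norm (frequency r k)" for k
    unfolding index_norm_def
  proof (rule norm_diagonal_le)
    fix i
    have "\<bar>(\<chi> i. real_of_int (k $ i)) $ i\<bar> = r $ i / (2 * pi) * \<bar>frequency r k $ i\<bar>"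
      using assms[of i] by (simp add: frequency_def abs_mult)
    also have "\<dots> \<le> C * \<bar>frequency r k $ i\<bar>" by (intro mult_right_mono C) auto
    finally show "\<bar>(\<chi> i. real_of_int (k $ i)) $ i\<bar> \<le> C * \<bar>frequency r k $ i\<bar>" .
  qed (rule C0)
  with C0 show ?thesis by (rule that)
qed

section \<open>Absorption of powers by exponentials\<close>

lemma powr_mult_exp_minus_le:
  fixes b q x :: real
  assumes "0 < b" "0 \<le> q" "0 < x"
  shows "x powr q * exp (- (b * x)) \<le> max 1 ((q / b) powr q)"
\<comment> \<open>As \<open>0 powr 0 = 0\<close>, the constant \<open>(q / b) powr q\<close> is 0
  for \<open>q = 0\<close>; the maximum with 1 covers this case.\<close>
proof (cases "q = 0")
  case True
  then show ?thesis using assms by simp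
next
  case False
  then have q: "0 < q" using assms by simp
  have "b * x / q \<le> exp (b * x / q)"
    using exp_ge_add_one_self[of "b * x / q"] by linarith
  then have "(b * x / q) powr q \<le> exp (b * x / q) powr q"
    using assms by (intro powr_mono2) auto
  also have "\<dots> = exp (b * x)" using q by (simp add: exp_powr_real)
  finally have "(q / b) powr q * (b * x / q) powr q \<le> (q / b) powr q * exp (b * x)"
    by (intro mult_left_mono) auto
  also have "(q / b) powr q * (b * x / q) powr q = x powr q"
    using assms q by (simp add: powr_mult[symmetric])
  finally have "x powr q * exp (- (b * x)) \<le> (q / b) powr q"
    by (simp add: exp_minus field_simps)
  then show ?thesis by simp
qed

lemma power_mult_exp_bounded:
  fixes b :: real
  assumes "0 < b"
  obtains B where "\<And>x. x \<le> 0 \<Longrightarrow> \<bar>x\<bar> ^ N * exp (x * b) \<le> B"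
proof -
  have "\<bar>x\<bar> ^ N * exp (x * b) \<le> max 1 ((real N / b) powr real N)" if "x \<le> 0" for x
  \<comment> \<open>Passing from \<open>^\<close> to \<open>powr\<close> needs a positive base. At 0
    the value is 1 or 0 according to whether \<open>N = 0\<close>.\<close>
  proof (cases "x = 0")
    case True
    then show ?thesis by (cases N) auto
  next
    case False
    then show ?thesis
      using powr_mult_exp_minus_le[of b "real N" "- x"] assms that
      by (simp add: powr_realpow mult.commute)
  qed
  then show ?thesis by (rule that)
qed

text \<open>For \<open>\<beta> > n\<close> the size of the index is controlled by \<open>w\<close>,
  and \<open>exp (- c * t * w powr \<epsilon>)\<close> beats every power of
  \<open>w\<close>.\<close>

lemma index_powr_mult_exp_multiplier_bounded:
  fixes r :: "real ^ 'n::finite"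
  assumes "\<And>i. 0 < r $ i" "0 < \<delta>" "real CARD('n) < \<beta>" "\<beta> < real CARD('n) + 4" "0 < t"
  obtains B where "\<And>k. (1 + (index_norm k)\<^sup>2) powr R * exp (multiplier \<delta> \<beta> (frequency r k) * t) \<le> B"
proof -
  let ?m = "\<lambda>k. multiplier \<delta> \<beta> (frequency r k)"
  obtain c \<epsilon> where c: "0 < c" "0 < \<epsilon>"
    and decay: "\<And>\<nu> :: real ^ 'n. 1 \<le> \<delta>\<^sup>2 / 4 * (norm \<nu>)\<^sup>2 \<Longrightarrow>
      multiplier \<delta> \<beta> \<nu> \<le> - c * (\<delta>\<^sup>2 / 4 * (norm \<nu>)\<^sup>2) powr \<epsilon>"
    using multiplier_decay[OF assms(2-4)] by blast
  obtain C where C: "0 \<le> C" "\<And>k. index_norm k \<le> C * norm (frequency r k)"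
    using index_norm_le[OF assms(1)] by blast
  \<comment> \<open>Chosen so that \<open>1 + (index_norm k)\<^sup>2 \<le> A * max 1 w\<close>; the
    maximum separates the range \<open>w \<ge> 1\<close>, where the decay holds, from the
    rest.\<close>
  define A where "A = 1 + C\<^sup>2 * (4 / \<delta>\<^sup>2)"
  have A: "1 \<le> A" by (simp add: A_def)
  define M where "M = max 1 (((\<bar>R\<bar> / \<epsilon>) / (c * t)) powr (\<bar>R\<bar> / \<epsilon>))"
  have "(1 + (index_norm k)\<^sup>2) powr R * exp (?m k * t) \<le> A powr \<bar>R\<bar> * M" for k
  proof -
    define w where "w = \<delta>\<^sup>2 / 4 * (norm (frequency r k))\<^sup>2"
    have w0: "0 \<le> w" by (simp add: w_def)
    have "(index_norm k)\<^sup>2 \<le> (C * norm (frequency r k))\<^sup>2"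
      using C by (intro power_mono) (auto simp: index_norm_def)
    also have "\<dots> = C\<^sup>2 * (4 / \<delta>\<^sup>2) * w"
      using assms(2) by (simp add: w_def power_mult_distrib)
    also have "\<dots> \<le> C\<^sup>2 * (4 / \<delta>\<^sup>2) * max 1 w" by (intro mult_left_mono) auto
    finally have "1 + (index_norm k)\<^sup>2 \<le> max 1 w + C\<^sup>2 * (4 / \<delta>\<^sup>2) * max 1 w"
      by (intro add_mono) auto
    then have k: "1 + (index_norm k)\<^sup>2 \<le> A * max 1 w" by (simp add: A_def distrib_right)
    have "(1 + (index_norm k)\<^sup>2) powr R \<le> (1 + (index_norm k)\<^sup>2) powr \<bar>R\<bar>"
      by (intro powr_mono) auto
    also have "\<dots> \<le> (A * max 1 w) powr \<bar>R\<bar>" by (intro powr_mono2 k) auto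
    also have "\<dots> = A powr \<bar>R\<bar> * max 1 w powr \<bar>R\<bar>" using A by (simp add: powr_mult)
    finally have le: "(1 + (index_norm k)\<^sup>2) powr R * exp (?m k * t)
        \<le> A powr \<bar>R\<bar> * max 1 w powr \<bar>R\<bar> * exp (?m k * t)"
      by (intro mult_right_mono) auto
    have "max 1 w powr \<bar>R\<bar> * exp (?m k * t) \<le> M"
    proof (cases "1 \<le> w")
      case False
      have "?m k * t \<le> 0"
        using multiplier_nonpos[OF assms(2,4)] assms(5) by (intro mult_nonpos_nonneg) auto
      then have "max 1 w powr \<bar>R\<bar> * exp (?m k * t) \<le> 1" using False by simp
      also have "1 \<le> M" by (simp add: M_def)
      finally show ?thesis .
    next
      case True
      have "?m k * t \<le> - c * w powr \<epsilon> * t"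
        using decay[of "frequency r k"] True assms(5) unfolding w_def by (intro mult_right_mono) auto
      then have "max 1 w powr \<bar>R\<bar> * exp (?m k * t) \<le> w powr \<bar>R\<bar> * exp (- (c * t * w powr \<epsilon>))"
        using True by (intro mult_mono) (auto simp: mult_ac max_def)
      \<comment> \<open>In the variable \<open>w powr \<epsilon>\<close> the decay is a plain
        exponential, and \<open>M\<close> is the constant of \<open>powr_mult_exp_minus_le\<close>
        for the exponent \<open>|R| / \<epsilon>\<close>.\<close>
      also have "w powr \<bar>R\<bar> = (w powr \<epsilon>) powr (\<bar>R\<bar> / \<epsilon>)"
        using c by (simp add: powr_powr)
      also have "\<dots> * exp (- (c * t * w powr \<epsilon>)) \<le> M"
        unfolding M_def using c assms(5) True by (intro powr_mult_exp_minus_le) auto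
      finally show ?thesis .
    qed
    then have "A powr \<bar>R\<bar> * (max 1 w powr \<bar>R\<bar> * exp (?m k * t)) \<le> A powr \<bar>R\<bar> * M"
      by (intro mult_left_mono) auto
    with le show ?thesis by (simp only: mult.assoc)
  qed
  then show ?thesis by (rule that)
qed

section \<open>Sobolev spaces and differentiation\<close>

lemma periodic_distribution_scale:
  assumes "periodic_distribution h" "0 \<le> C"
    and "\<And>k. cmod (g k) \<le> C * (1 + (index_norm k)\<^sup>2) powr p * cmod (h k)"
  shows "periodic_distribution g"
proof -
  obtain D q where h: "\<And>k. cmod (h k) \<le> D * (1 + (index_norm k)\<^sup>2) powr q"
    using assms(1) unfolding periodic_distribution_def by blast
  have "cmod (g k) \<le> (C * D) * (1 + (index_norm k)\<^sup>2) powr (p + q)" for k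
  proof -
    have "cmod (g k) \<le> C * (1 + (index_norm k)\<^sup>2) powr p * (D * (1 + (index_norm k)\<^sup>2) powr q)"
      using assms(2) by (intro order_trans[OF assms(3)] mult_left_mono h) auto
    then show ?thesis by (simp add: powr_add mult_ac)
  qed
  then show ?thesis unfolding periodic_distribution_def by blast
qed

text \<open>Half of the difference of orders is the weight on amplitudes, since the norm squares
  them. A pointwise comparison with \<open>f\<close> thus changes the order from \<open>s\<close> to
  \<open>q\<close>.\<close>

lemma sobolev_scale:
  assumes f: "f \<in> sobolev_space s" and "0 \<le> B"
    and g: "\<And>k. (1 + (index_norm k)\<^sup>2) powr ((q - s) / 2) * cmod (g k) \<le> B * cmod (f k)"
  shows "g \<in> sobolev_space q" and "sobolev_norm q g \<le> B * sobolev_norm s f"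
proof -
  let ?\<kappa> = "\<lambda>k. 1 + (index_norm k)\<^sup>2"
  have \<kappa>: "0 < ?\<kappa> k" for k :: "int ^ 'a" by (simp add: add_pos_nonneg)
  have f_sum: "(\<lambda>k. ?\<kappa> k powr s * (cmod (f k))\<^sup>2) summable_on UNIV"
    using f by (simp add: sobolev_space_def)
  have le: "?\<kappa> k powr q * (cmod (g k))\<^sup>2 \<le> B\<^sup>2 * (?\<kappa> k powr s * (cmod (f k))\<^sup>2)" for k
  proof -
    have "?\<kappa> k powr q = ?\<kappa> k powr s * (?\<kappa> k powr ((q - s) / 2))\<^sup>2"
      by (simp add: power2_eq_square powr_add[symmetric])
    then have "?\<kappa> k powr q * (cmod (g k))\<^sup>2
        = ?\<kappa> k powr s * (?\<kappa> k powr ((q - s) / 2) * cmod (g k))\<^sup>2"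
      by (simp add: power_mult_distrib)
    also have "\<dots> \<le> ?\<kappa> k powr s * (B * cmod (f k))\<^sup>2"
      by (intro mult_left_mono power_mono g) auto
    finally show ?thesis by (simp add: power_mult_distrib mult_ac)
  qed
  have bound_sum: "(\<lambda>k. B\<^sup>2 * (?\<kappa> k powr s * (cmod (f k))\<^sup>2)) summable_on UNIV"
    using f_sum by (rule summable_on_cmult_right)
  have g_sum: "(\<lambda>k. ?\<kappa> k powr q * (cmod (g k))\<^sup>2) summable_on UNIV"
    using bound_sum by (rule summable_on_comparison_test) (use le in auto)
  have "periodic_distribution g"
  proof (rule periodic_distribution_scale)
    show "periodic_distribution f" using f by (simp add: sobolev_space_def)
    fix k
    \<comment> \<open>Undoing the weight bounds \<open>g\<close> by a power of the weight times
      \<open>f\<close>, so polynomial growth is inherited.\<close>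
    have "cmod (g k) = ?\<kappa> k powr ((s - q) / 2) * (?\<kappa> k powr ((q - s) / 2) * cmod (g k))"
      using \<kappa>[of k] by (simp add: mult.assoc[symmetric] powr_add[symmetric] add_divide_distrib[symmetric])
    also have "\<dots> \<le> ?\<kappa> k powr ((s - q) / 2) * (B * cmod (f k))"
      by (intro mult_left_mono g) auto
    finally show "cmod (g k) \<le> B * ?\<kappa> k powr ((s - q) / 2) * cmod (f k)"
      by (simp add: mult_ac)
  qed (rule assms(2))
  with g_sum show "g \<in> sobolev_space q" by (simp add: sobolev_space_def)
  have "(\<Sum>\<^sub>\<infinity>k. ?\<kappa> k powr q * (cmod (g k))\<^sup>2) \<le> (\<Sum>\<^sub>\<infinity>k. B\<^sup>2 * (?\<kappa> k powr s * (cmod (f k))\<^sup>2))"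
    by (intro infsum_mono g_sum bound_sum le)
  also have "\<dots> = B\<^sup>2 * (\<Sum>\<^sub>\<infinity>k. ?\<kappa> k powr s * (cmod (f k))\<^sup>2)"
    by (rule infsum_cmult_right')
  finally have "sobolev_norm q g \<le> sqrt (B\<^sup>2 * (\<Sum>\<^sub>\<infinity>k. ?\<kappa> k powr s * (cmod (f k))\<^sup>2))"
    unfolding sobolev_norm_def by (rule real_sqrt_le_mono)
  then show "sobolev_norm q g \<le> B * sobolev_norm s f"
    using assms(2) by (simp add: sobolev_norm_def real_sqrt_mult)
qed

lemma sobolev_norm_nonneg: "0 \<le> sobolev_norm s h"
  unfolding sobolev_norm_def by (intro real_sqrt_ge_zero infsum_nonneg) auto

section \<open>Convergence of the difference quotients\<close>

lemma difference_quotient_exp_bound: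
  fixes \<mu> h t :: real
  assumes "\<mu> \<le> 0" "h \<noteq> 0" "\<bar>h\<bar> \<le> t / 2"
  shows "\<bar>(\<mu> ^ N * exp (\<mu> * (t + h)) - \<mu> ^ N * exp (\<mu> * t)) / h - \<mu> ^ (N + 1) * exp (\<mu> * t)\<bar>
    \<le> \<bar>h\<bar> * (\<bar>\<mu>\<bar> ^ (N + 2) * exp (\<mu> * (t / 2)))"
proof -
  \<comment> \<open>The first-order Taylor remainder brings in
    \<open>exp \<bar>\<mu> * h\<bar>\<close>, which \<open>exp (\<mu> * t)\<close> has to
    absorb.\<close>
  have "\<bar>exp (\<mu> * h) - 1 - \<mu> * h\<bar> \<le> exp \<bar>\<mu> * h\<bar> * (\<mu> * h)\<^sup>2"
    using Taylor_exp_field[of "\<mu> * h" 1] by (simp add: numeral_2_eq_2 abs_mult algebra_simps)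
  then have "exp (\<mu> * t) * \<bar>exp (\<mu> * h) - 1 - \<mu> * h\<bar> \<le> exp (\<mu> * t) * (exp \<bar>\<mu> * h\<bar> * (\<mu> * h)\<^sup>2)"
    by (intro mult_left_mono) auto
  also have "\<dots> = exp (\<mu> * t + \<bar>\<mu> * h\<bar>) * (\<mu> * h)\<^sup>2" by (simp add: exp_add)
  also have "\<dots> \<le> exp (\<mu> * (t / 2)) * (\<mu> * h)\<^sup>2"
  proof -
    \<comment> \<open>As \<open>\<mu> \<le> 0\<close>, the absolute value is
      \<open>- \<mu> * \<bar>h\<bar>\<close>; the restriction on \<open>h\<close> leaves at least
      half of the decay.\<close>
    have "\<mu> * t + \<bar>\<mu> * h\<bar> = \<mu> * (t - \<bar>h\<bar>)" using assms(1) by (simp add: abs_mult algebra_simps)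
    also have "\<dots> \<le> \<mu> * (t / 2)" using assms by (intro mult_left_mono_neg) auto
    finally show ?thesis by (intro mult_right_mono) auto
  qed
  finally have le: "exp (\<mu> * t) * \<bar>exp (\<mu> * h) - 1 - \<mu> * h\<bar> \<le> exp (\<mu> * (t / 2)) * (\<mu> * h)\<^sup>2" .
  have "(\<mu> ^ N * exp (\<mu> * (t + h)) - \<mu> ^ N * exp (\<mu> * t)) / h - \<mu> ^ (N + 1) * exp (\<mu> * t)
      = \<mu> ^ N * (exp (\<mu> * t) * (exp (\<mu> * h) - 1 - \<mu> * h)) / h"
    using assms(2) by (simp add: distrib_left exp_add field_simps)
  also have "\<bar>\<dots>\<bar> = \<bar>\<mu>\<bar> ^ N * (exp (\<mu> * t) * \<bar>exp (\<mu> * h) - 1 - \<mu> * h\<bar>) / \<bar>h\<bar>"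
    by (simp add: abs_mult power_abs)
  also have "\<dots> \<le> \<bar>\<mu>\<bar> ^ N * (exp (\<mu> * (t / 2)) * (\<mu> * h)\<^sup>2) / \<bar>h\<bar>"
    by (intro divide_right_mono mult_left_mono le) auto
  also have "\<dots> = \<bar>h\<bar> * (\<bar>\<mu>\<bar> ^ (N + 2) * exp (\<mu> * (t / 2)))"
  proof -
    have "(\<mu> * h)\<^sup>2 = \<bar>\<mu>\<bar> ^ 2 * (\<bar>h\<bar> * \<bar>h\<bar>)" by (simp add: power_mult_distrib power2_eq_square)
    moreover have "x ^ N * (e * (x ^ 2 * (y * y))) / y = y * (x ^ (N + 2) * e)" if "y \<noteq> 0" for x y e :: real
      using that by (simp add: power_add power2_eq_square)
    ultimately show ?thesis using assms(2) by (simp only: abs_eq_0 not_False_eq_True)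
  qed
  finally show ?thesis .
qed

text \<open>The parameter \<open>\<beta>\<close> enters only through \<open>smoothing\<close>: the
  exponential absorbs the change of order from \<open>s\<close> to \<open>q\<close>.\<close>

lemma has_gateaux_derivative_exp_multiplier:
  fixes \<mu> :: "int ^ 'n::finite \<Rightarrow> real"
  assumes f: "f \<in> sobolev_space s" and \<mu>: "\<And>k. \<mu> k \<le> 0" and "0 < t"
    and W: "\<And>\<tau> k. 0 \<le> \<tau> \<Longrightarrow> W \<tau> k = f k * of_real (\<mu> k ^ N * exp (\<mu> k * \<tau>))"
    and Z: "\<And>k. Z k = f k * of_real (\<mu> k ^ (N + 1) * exp (\<mu> k * t))"
    and smoothing: "\<And>q b. q \<in> Q \<Longrightarrow> 0 < b \<Longrightarrow>
      \<exists>B. \<forall>k. (1 + (index_norm k)\<^sup>2) powr ((q - s) / 2) * exp (\<mu> k * b) \<le> B"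
  shows "has_gateaux_derivative Q W Z t"
  unfolding has_gateaux_derivative_def
proof (intro ballI)
  fix q assume q: "q \<in> Q"
  let ?\<kappa> = "\<lambda>k. 1 + (index_norm k)\<^sup>2"
  let ?R = "\<lambda>h k. (W (t + h) k - W t k) / of_real h - Z k"
  have "0 < t / 4" using assms(3) by simp
  then obtain B where B: "\<And>k. ?\<kappa> k powr ((q - s) / 2) * exp (\<mu> k * (t / 4)) \<le> B"
    using smoothing[OF q] by blast
  obtain M where M: "\<And>x. x \<le> 0 \<Longrightarrow> \<bar>x\<bar> ^ (N + 2) * exp (x * (t / 4)) \<le> M"
    using power_mult_exp_bounded[OF \<open>0 < t / 4\<close>] by blast
  have B0: "0 \<le> B" by (rule order_trans[OF _ B[of 0]]) simp
  have M0: "0 \<le> M" by (rule order_trans[OF _ M[of 0]]) simp_all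
  have bound: "?\<kappa> k powr ((q - s) / 2) * cmod (?R h k) \<le> (\<bar>h\<bar> * (B * M)) * cmod (f k)"
    if h: "h \<noteq> 0" "\<bar>h\<bar> \<le> t / 2" for h k
  proof -
    \<comment> \<open>\<open>W\<close> is known only at nonnegative times, and
      \<open>\<bar>h\<bar> \<le> t / 2\<close> keeps \<open>t + h\<close> there.\<close>
    have th: "0 \<le> t + h" "0 \<le> t" using h assms(3) by auto
    have "?R h k = f k * of_real ((\<mu> k ^ N * exp (\<mu> k * (t + h)) - \<mu> k ^ N * exp (\<mu> k * t)) / h
        - \<mu> k ^ (N + 1) * exp (\<mu> k * t))"
      unfolding W[OF th(1)] W[OF th(2)] Z by (simp add: diff_divide_distrib right_diff_distrib)
    then have "cmod (?R h k) = cmod (f k) * \<bar>(\<mu> k ^ N * exp (\<mu> k * (t + h)) - \<mu> k ^ N * exp (\<mu> k * t)) / h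
        - \<mu> k ^ (N + 1) * exp (\<mu> k * t)\<bar>"
      by (simp only: norm_mult norm_of_real)
    also have "\<dots> \<le> cmod (f k) * (\<bar>h\<bar> * (\<bar>\<mu> k\<bar> ^ (N + 2) * exp (\<mu> k * (t / 2))))"
      by (intro mult_left_mono difference_quotient_exp_bound \<mu> h) auto
    \<comment> \<open>One factor is paired with the Sobolev weight and bounded by \<open>B\<close>,
      the other with the powers of \<open>\<mu> k\<close> and bounded by \<open>M\<close>.\<close>
    also have "exp (\<mu> k * (t / 2)) = exp (\<mu> k * (t / 4)) * exp (\<mu> k * (t / 4))"
      by (simp add: exp_add[symmetric])
    finally have "?\<kappa> k powr ((q - s) / 2) * cmod (?R h k) \<le> ?\<kappa> k powr ((q - s) / 2) *
        (cmod (f k) * (\<bar>h\<bar> * (\<bar>\<mu> k\<bar> ^ (N + 2) * (exp (\<mu> k * (t / 4)) * exp (\<mu> k * (t / 4))))))"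
      by (intro mult_left_mono) auto
    also have "\<dots> = cmod (f k) * \<bar>h\<bar> * ((?\<kappa> k powr ((q - s) / 2) * exp (\<mu> k * (t / 4)))
        * (\<bar>\<mu> k\<bar> ^ (N + 2) * exp (\<mu> k * (t / 4))))"
      by (simp only: mult_ac)
    also have "\<dots> \<le> cmod (f k) * \<bar>h\<bar> * (B * M)"
      using B0 by (intro mult_left_mono mult_mono B M \<mu>) auto
    finally show ?thesis by (simp only: mult_ac)
  qed
  have near: "\<forall>\<^sub>F h in at 0. h \<noteq> 0 \<and> \<bar>h\<bar> \<le> t / 2"
    unfolding eventually_at by (rule exI[of _ "t / 2"]) (use assms(3) in auto)
  have BM: "0 \<le> \<bar>h\<bar> * (B * M)" for h using B0 M0 by simp
  have "\<forall>\<^sub>F h in at 0. ?R h \<in> sobolev_space q"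
    using near by eventually_elim (rule sobolev_scale(1)[OF f BM bound], auto)
  moreover have "((\<lambda>h. sobolev_norm q (?R h)) \<longlongrightarrow> 0) (at 0)"
  proof (rule tendsto_sandwich)
    show "\<forall>\<^sub>F h in at 0. 0 \<le> sobolev_norm q (?R h)" by (simp add: sobolev_norm_nonneg)
    show "\<forall>\<^sub>F h in at 0. sobolev_norm q (?R h) \<le> \<bar>h\<bar> * (B * M) * sobolev_norm s f"
      using near by eventually_elim (rule sobolev_scale(2)[OF f BM bound], auto)
    show "((\<lambda>h. \<bar>h\<bar> * (B * M) * sobolev_norm s f) \<longlongrightarrow> 0) (at 0)"
      by (auto intro!: tendsto_eq_intros)
  qed auto
  ultimately show "(\<forall>\<^sub>F h in at 0. ?R h \<in> sobolev_space q) \<and>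
      ((\<lambda>h. sobolev_norm q (?R h)) \<longlongrightarrow> 0) (at 0)" by blast
qed

theorem proposition1:
  fixes r :: "real ^ 'n::finite" and \<delta> \<beta> s :: real and f :: "'n fourier_coeffs"
    and N :: nat and U U\<^sub>N V\<^sub>N :: "real \<Rightarrow> 'n fourier_coeffs"
  assumes "\<And>i. 0 < r $ i" and "0 < \<delta>" and "\<beta> < real CARD('n) + 4"
    and "f \<in> sobolev_space s"
    and "\<And>t k. 0 \<le> t \<Longrightarrow>
      U t k = f k * of_real (exp (multiplier \<delta> \<beta> (frequency r k) * t))"
    and "\<And>t k. 0 \<le> t \<Longrightarrow>
      U\<^sub>N t k = f k * of_real (multiplier \<delta> \<beta> (frequency r k) ^ N
                              * exp (multiplier \<delta> \<beta> (frequency r k) * t))"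
    and "\<And>t k. 0 \<le> t \<Longrightarrow>
      V\<^sub>N t k = f k * of_real (multiplier \<delta> \<beta> (frequency r k) ^ (N + 1)
                              * exp (multiplier \<delta> \<beta> (frequency r k) * t))"
  shows "(\<forall>t\<ge>0. periodic_distribution (U t) \<and> periodic_distribution (U\<^sub>N t)
                \<and> periodic_distribution (V\<^sub>N t))
       \<and> (\<forall>t>0. has_gateaux_derivative (gateaux_orders TYPE('n) \<beta> s) U\<^sub>N (V\<^sub>N t) t)
       \<and> has_nth_gateaux_derivative (gateaux_orders TYPE('n) \<beta> s) N U U\<^sub>N"
proof -
  define \<mu> where "\<mu> = (\<lambda>k. multiplier \<delta> \<beta> (frequency r k))"
  define Q where "Q = gateaux_orders TYPE('n) \<beta> s"
  define Y where "Y = (\<lambda>j t k. f k * of_real (\<mu> k ^ j * exp (\<mu> k * t)))"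
  have \<mu>: "\<mu> k \<le> 0" for k unfolding \<mu>_def by (rule multiplier_nonpos[OF assms(2,3)])
  have U: "U t = Y 0 t" "U\<^sub>N t = Y N t" "V\<^sub>N t = Y (Suc N) t" if "0 \<le> t" for t
    using assms(5-7)[OF that] by (auto simp: Y_def \<mu>_def)

  obtain C where C: "0 \<le> C" "\<And>\<nu> :: real ^ 'n. \<bar>multiplier \<delta> \<beta> \<nu>\<bar> \<le> C * (1 + (norm \<nu>)\<^sup>2)\<^sup>2"
    using multiplier_growth[OF assms(2,3)] by blast
  obtain D where D: "0 \<le> D" "\<And>k. norm (frequency r k) \<le> D * index_norm k"
    using norm_frequency_le[OF assms(1)] by blast
  \<comment> \<open>At \<open>t = 0\<close> there is no decay, so the powers of \<open>\<mu>\<close>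
    must themselves grow at most polynomially.\<close>
  have \<mu>_growth: "\<bar>\<mu> k\<bar> \<le> C * (1 + D\<^sup>2)\<^sup>2 * (1 + (index_norm k)\<^sup>2) powr 2" for k
  proof -
    have "(norm (frequency r k))\<^sup>2 \<le> (D * index_norm k)\<^sup>2" by (intro power_mono D) auto
    then have "1 + (norm (frequency r k))\<^sup>2 \<le> 1 + D\<^sup>2 * (index_norm k)\<^sup>2"
      by (simp add: power_mult_distrib)
    also have "\<dots> \<le> (1 + D\<^sup>2) * (1 + (index_norm k)\<^sup>2)" by (simp add: distrib_left distrib_right)
    finally have "C * (1 + (norm (frequency r k))\<^sup>2)\<^sup>2 \<le> C * ((1 + D\<^sup>2) * (1 + (index_norm k)\<^sup>2))\<^sup>2"
      using C by (intro mult_left_mono power_mono) auto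
    moreover have "(1 + (index_norm k)\<^sup>2) powr 2 = (1 + (index_norm k)\<^sup>2)\<^sup>2"
      using powr_realpow[of "1 + (index_norm k)\<^sup>2" 2] by (simp add: add_pos_nonneg)
    ultimately show ?thesis
      using C(2)[of "frequency r k"] by (simp add: \<mu>_def power_mult_distrib mult.assoc)
  qed
  have periodic: "periodic_distribution (Y j t)" if t: "0 \<le> t" for j t
  proof (rule periodic_distribution_scale)
    show "periodic_distribution f" using assms(4) by (simp add: sobolev_space_def)
    show "0 \<le> (C * (1 + D\<^sup>2)\<^sup>2) ^ j" using C by simp
    fix k
    have "exp (\<mu> k * t) \<le> 1" using \<mu>[of k] t by (simp add: mult_nonpos_nonneg)
    then have "\<bar>\<mu> k\<bar> ^ j * exp (\<mu> k * t) \<le> (C * (1 + D\<^sup>2)\<^sup>2 * (1 + (index_norm k)\<^sup>2) powr 2) ^ j * 1"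
      using C(1) by (intro mult_mono power_mono \<mu>_growth) auto
    also have "\<dots> = (C * (1 + D\<^sup>2)\<^sup>2) ^ j * (1 + (index_norm k)\<^sup>2) powr (2 * real j)"
      using powr_realpow[of "1 + (index_norm k)\<^sup>2" "2 * j"]
      by (simp add: power_mult_distrib power_mult add_pos_nonneg)
    finally show "cmod (Y j t k) \<le> (C * (1 + D\<^sup>2)\<^sup>2) ^ j * (1 + (index_norm k)\<^sup>2) powr (2 * real j) * cmod (f k)"
      by (simp add: Y_def norm_mult norm_power mult.commute mult_left_mono)
  qed

  have smoothing: "\<exists>B. \<forall>k. (1 + (index_norm k)\<^sup>2) powr ((q - s) / 2) * exp (\<mu> k * b) \<le> B"
    if "q \<in> Q" "0 < b" for q b
  proof (cases "\<beta> \<le> real CARD('n)")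
    case True
    \<comment> \<open>Here \<open>Q\<close> contains only \<open>s\<close>, so the weight has
      exponent 0 and equals 1.\<close>
    have "exp (\<mu> k * b) \<le> 1" for k using \<mu>[of k] that by (simp add: mult_nonpos_nonneg)
    with True that(1) show ?thesis
      by (intro exI[of _ 1]) (simp add: Q_def gateaux_orders_def)
  next
    case False
    then show ?thesis
      using index_powr_mult_exp_multiplier_bounded[OF assms(1,2) _ assms(3) that(2), of "(q - s) / 2"]
      unfolding \<mu>_def by (metis not_le)
  qed
  have gateaux: "has_gateaux_derivative Q W (Y (Suc j) t) t"
    if "0 < t" "\<And>\<tau>. 0 \<le> \<tau> \<Longrightarrow> W \<tau> = Y j \<tau>" for W j t
    using assms(4) \<mu> that(1) _ _ smoothing
    by (rule has_gateaux_derivative_exp_multiplier[where N = j]) (simp_all add: that(2) Y_def)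
  \<comment> \<open>\<open>Z\<close> is prescribed at positive times only, as in the recursion; in
    the induction step \<open>Y j\<close> is the intermediate derivative.\<close>
  have iterated: "has_nth_gateaux_derivative Q j U Z" if "\<And>t. 0 < t \<Longrightarrow> Z t = Y j t" for Z j
    using that
  proof (induction j arbitrary: Z)
    case 0
    then show ?case by (simp add: U)
  next
    case (Suc j)
    then show ?case using gateaux[of _ "Y j" j] by auto
  qed
  show ?thesis
    unfolding Q_def[symmetric] using periodic gateaux iterated U by auto
qed

end
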